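(* Let $\mathbf I=\mathrm{diag}(I_1,I_2,I_2)$ with $0<I_i<\tfrac12$ and $I_1+2I_2=1$. Let $((\mathrm{Id},\mathbf R),(\xi,\eta))$ be a relative equilibrium of the axisymmetric second order model satisfying $\xi\cdot\mathbf R=0$. Then, up to translation by elements of $G^{\mathrm{axi}}$, it belongs to one of the following cases. (Cylindrical) There are $R>0$ and $\alpha\in\mathbb R$ such that $$\xi=(\xi_1,0,0),\quad \mathbf R=(0,R,0),\quad |\xi|^2=\frac{2R^2+3-9I_2}{2R^5},\quad \eta=-\alpha\xi_1 .$$ (Hyperbolic) There are $R>0$ and $\theta\in S^1$, $\theta\ne\frac\pi2$, such that $$\xi=|\xi|(\sin\theta,0,\cos\theta),\quad \mathbf R=(0,R,0),\quad |\xi|^2=\frac{2R^2+3-9I_2}{2R^5},\quad \eta=-\frac{I_2-I_1}{I_1}|\xi|\sin\theta .$$ (Isolated) There is $R>0$ such that $$\xi=(0,\xi_2,0),\quad \mathbf R=(R,0,0),\quad |\xi|^2=\frac{2R^2+3-9I_1}{2R^5},\quad \eta=0 .$$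
   Context: Axisymmetric second order satellite model. Units are chosen so that the satellite has mass $1$ and its inertia tensor $\mathbf I=\mathrm{diag}(I_1,I_2,I_2)$ has trace $1$; the first body axis $\mathbf e_1$ is the symmetry axis. The configuration space is $Q=SO(3)\times\mathbb R^3$ with points $(B,\mathbf R)$ in body coordinates (the potential below being defined for $\mathbf R\neq0$). Tangent vectors are written $(\Omega,\dot{\mathbf R})\in\mathbb R^3\times\mathbb R^3$ with $\dot B=B\widehat\Omega$, where $\widehat\Omega u=\Omega\times u$. The kinetic energy is $K=\frac12(\Omega\cdot\mathbf I\Omega+|\dot{\mathbf R}+\Omega\times\mathbf R|^2)$, the potential is $$V_2(\mathbf R)=-\frac1R-\frac1{2R^3}+\frac{3}{2R^5}\,\mathbf R\cdot\mathbf I\mathbf R,\qquad R=|\mathbf R|,$$ and the system on $T^*Q$ has Hamiltonian $H_2=K+V_2$. Symmetry. Let $\Gamma^{\mathrm{axi}}\subset O(3)$ be the group of block matrices $\mathrm{diag}(s,O)$ with $s\in\{1,-1\}$, $O\in O(2)$, let $\chi(\mathrm{diag}(s,O))=\det O$, and let $G^{\mathrm{axi}}=SO(3)\times\Gamma^{\mathrm{axi}}$ act on $Q$ by $(M,N)\cdot(B,\mathbf R)=(MBN^T\det N,\,N\mathbf R)$. Its Lie algebra is identified with $\mathbb R^3\oplus\mathbb R$, where $(\xi,\eta)$ generates $(\exp(t\widehat\xi),\exp(t\eta\,\widehat{\mathbf e_1}))$; the adjoint action is $(M,N)\cdot(\xi,\eta)=(M\xi,\chi(N)\eta)$. Translating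 a pair $(q,(\xi,\eta))$ by $g\in G^{\mathrm{axi}}$ gives $(g\cdot q,\mathrm{Ad}_g(\xi,\eta))$. A relative equilibrium with velocity $(\xi,\eta)$ is a phase space point whose evolution is the orbit of the one-parameter subgroup generated by $(\xi,\eta)$; it is encoded by a pair $((B,\mathbf R),(\xi,\eta))$ such that $(B,\mathbf R)$ is a critical point of $V_{(\xi,\eta)}=V_2-\frac12\lVert(\xi,\eta)_Q\rVert^2$, where $(\xi,\eta)_Q(B,\mathbf R)=(B^T\xi-\eta\mathbf e_1,\ \eta\,\mathbf e_1\times\mathbf R)$ is the infinitesimal generator and the norm is that of the metric $2K$. For $B=\mathrm{Id}$ this is equivalent to $$\xi\times\big((\mathbf I-\widehat{\mathbf R}\widehat{\mathbf R})\xi-I_1\eta\,\mathbf e_1\big)=0,\qquad \nabla_{\mathbf R}V_2(\mathbf R)+\xi(\mathbf R\cdot\xi)-\mathbf R|\xi|^2=0 .$$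
   Formalization: The formal theorem also assumes that ξ ≠ 0 or η = 0, and that I₁ ≠ I₂ or η ≠ 0; the claim as stated fails for static equilibria with ξ = 0, η ≠ 0 and for the spherical case I₁ = I₂ = 1/3 with η = 0. *)

theory Defs
  imports "HOL-Analysis.Analysis"
begin

text \<open>
  A tangent vector to \<open>Q = SO(3) \<times> \<real>\<^sup>3\<close> at \<open>(B, R)\<close> is written \<open>(\<Omega>, R')\<close>, where
  \<open>B' v = B (cross3 \<Omega> v)\<close>.
\<close>

type_synonym config = "(real^3^3) \<times> (real^3)"
type_synonym velocity = "(real^3) \<times> real"

definition SO3 :: "(real^3^3) set" where
  "SO3 = {B. rotation_matrix B}"

definition config_space :: "config set" where
  "config_space = SO3 \<times> UNIV"

definition e1 :: "real^3" where
  "e1 = vector [1, 0, 0]"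

definition inertia :: "real \<Rightarrow> real \<Rightarrow> real^3^3" where
  "inertia I1 I2 = vector [vector [I1, 0, 0], vector [0, I2, 0], vector [0, 0, I2]]"

definition kinetic :: "real \<Rightarrow> real \<Rightarrow> config \<Rightarrow> (real^3) \<times> (real^3) \<Rightarrow> real" where
  "kinetic I1 I2 = (\<lambda>(B, R) (\<Omega>, R').
     1/2 * (\<Omega> \<bullet> (inertia I1 I2 *v \<Omega>) + (norm (R' + cross3 \<Omega> R))\<^sup>2))"

definition V2 :: "real \<Rightarrow> real \<Rightarrow> real^3 \<Rightarrow> real" where
  "V2 I1 I2 R = - 1 / norm R - 1 / (2 * norm R ^ 3)
     + 3 / (2 * norm R ^ 5) * (R \<bullet> (inertia I1 I2 *v R))"

text \<open>The symmetry group. \<open>\<chi>\<close> is meant to be applied to elements of \<open>\<Gamma>\<close> only, where it is the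
  determinant of the \<open>O(2)\<close> block.\<close>

definition block_diag :: "real \<Rightarrow> real^2^2 \<Rightarrow> real^3^3" where
  "block_diag s A = vector [vector [s, 0, 0], vector [0, A$1$1, A$1$2], vector [0, A$2$1, A$2$2]]"

definition Gamma_axi :: "(real^3^3) set" where
  "Gamma_axi = {block_diag s A | s A. s \<in> {1, -1} \<and> orthogonal_matrix A}"

definition chi_axi :: "real^3^3 \<Rightarrow> real" where
  "chi_axi N = det (vector [vector [N$2$2, N$2$3], vector [N$3$2, N$3$3]] :: real^2^2)"

definition G_axi :: "((real^3^3) \<times> (real^3^3)) set" where
  "G_axi = SO3 \<times> Gamma_axi"

definition act :: "(real^3^3) \<times> (real^3^3) \<Rightarrow> config \<Rightarrow> config" where
  "act = (\<lambda>(M, N) (B, R). (det N *\<^sub>R (M ** B ** transpose N), N *v R))"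

definition Ad :: "(real^3^3) \<times> (real^3^3) \<Rightarrow> velocity \<Rightarrow> velocity" where
  "Ad = (\<lambda>(M, N) (\<xi>, \<eta>). (M *v \<xi>, chi_axi N * \<eta>))"

definition translate :: "(real^3^3) \<times> (real^3^3) \<Rightarrow> config \<times> velocity \<Rightarrow> config \<times> velocity" where
  "translate g = (\<lambda>(q, \<zeta>). (act g q, Ad g \<zeta>))"

text \<open>\<open>(exp(t \<xi>^), exp(t \<eta> e1^)) \<cdot> (B, R)\<close> has this velocity at \<open>t = 0\<close>, in the above coordinates
  for tangent vectors.\<close>

definition generator :: "velocity \<Rightarrow> config \<Rightarrow> (real^3) \<times> (real^3)" where
  "generator = (\<lambda>(\<xi>, \<eta>) (B, R). (transpose B *v \<xi> - \<eta> *\<^sub>R e1, \<eta> *\<^sub>R cross3 e1 R))"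

text \<open>The squared norm in the Riemannian metric \<open>2K\<close> is \<open>2 * kinetic\<close>.\<close>

definition augmented_potential :: "real \<Rightarrow> real \<Rightarrow> velocity \<Rightarrow> config \<Rightarrow> real" where
  "augmented_potential I1 I2 \<zeta> q =
     V2 I1 I2 (snd q) - 1/2 * (2 * kinetic I1 I2 q (generator \<zeta> q))"

text \<open>\<open>Q\<close> is embedded in \<open>\<real>\<^sup>3\<^sup>\<times>\<^sup>3 \<times> \<real>\<^sup>3\<close>, so its tangent vectors at \<open>q\<close> are exactly the velocities
  at \<open>q\<close> of curves in \<open>Q\<close>; criticality is the vanishing of the derivative along all of them.\<close>

definition critical_point :: "(config \<Rightarrow> real) \<Rightarrow> config \<Rightarrow> bool" where
  "critical_point f q \<longleftrightarrow> q \<in> config_space \<and>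
     (\<forall>c :: real \<Rightarrow> config. range c \<subseteq> config_space \<and> c 0 = q \<and> c differentiable (at 0)
        \<longrightarrow> ((\<lambda>t. f (c t)) has_real_derivative 0) (at 0))"

definition relative_equilibrium :: "real \<Rightarrow> real \<Rightarrow> config \<times> velocity \<Rightarrow> bool" where
  "relative_equilibrium I1 I2 = (\<lambda>((B, R), \<zeta>).
     R \<noteq> 0 \<and> critical_point (augmented_potential I1 I2 \<zeta>) (B, R))"

definition cylindrical_RE :: "real \<Rightarrow> real \<Rightarrow> real^3 \<Rightarrow> velocity \<Rightarrow> bool" where
  "cylindrical_RE I1 I2 R = (\<lambda>(\<xi>, \<eta>). \<exists>r>0. \<exists>\<alpha> \<xi>1.
     \<xi> = vector [\<xi>1, 0, 0] \<and> R = vector [0, r, 0] \<and>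
     (norm \<xi>)\<^sup>2 = (2 * r^2 + 3 - 9 * I2) / (2 * r^5) \<and> \<eta> = - \<alpha> * \<xi>1)"

text \<open>\<open>S\<^sup>1 = \<real> / 2\<pi>\<int>\<close> is represented by its fundamental domain \<open>[0, 2\<pi>)\<close>.\<close>

definition hyperbolic_RE :: "real \<Rightarrow> real \<Rightarrow> real^3 \<Rightarrow> velocity \<Rightarrow> bool" where
  "hyperbolic_RE I1 I2 R = (\<lambda>(\<xi>, \<eta>). \<exists>r>0. \<exists>\<theta>\<in>{0..<2*pi}. \<theta> \<noteq> pi/2 \<and>
     \<xi> = norm \<xi> *\<^sub>R vector [sin \<theta>, 0, cos \<theta>] \<and> R = vector [0, r, 0] \<and>
     (norm \<xi>)\<^sup>2 = (2 * r^2 + 3 - 9 * I2) / (2 * r^5) \<and>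
     \<eta> = - ((I2 - I1) / I1) * norm \<xi> * sin \<theta>)"

definition isolated_RE :: "real \<Rightarrow> real \<Rightarrow> real^3 \<Rightarrow> velocity \<Rightarrow> bool" where
  "isolated_RE I1 I2 R = (\<lambda>(\<xi>, \<eta>). \<exists>r>0. \<exists>\<xi>2.
     \<xi> = vector [0, \<xi>2, 0] \<and> R = vector [r, 0, 0] \<and>
     (norm \<xi>)\<^sup>2 = (2 * r^2 + 3 - 9 * I1) / (2 * r^5) \<and> \<eta> = 0)"

end

theory Submission
  imports Defs
begin

text \<open>
  For \<open>\<xi> \<bullet> R = 0\<close> the two critical point equations reduce to
  \<open>((I1 - I2) \<xi>\<^sub>1 - I1 \<eta>) (\<xi> \<times> e\<^sub>1) = 0\<close> and \<open>\<nabla>V\<^sub>2(R) = |\<xi>|\<^sup>2 R\<close>. The second one makes \<open>R\<close> an eigenvector of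
  the inertia tensor and determines \<open>|\<xi>|\<^sup>2\<close>; the first one says that \<open>\<xi>\<close> is parallel to the symmetry axis
  or that \<open>\<eta>\<close> is determined by \<open>\<xi>\<^sub>1\<close>. Hence \<open>R\<close> is parallel or orthogonal to the axis; for \<open>I1 = I2\<close>, where every vector is an
  eigenvector, this holds because \<open>\<eta> \<noteq> 0\<close> forces \<open>\<xi>\<close> onto the axis. It remains to rotate about the symmetry axis and, if \<open>R\<close> lies on
  that axis, to reflect it.
\<close>

section \<open>Coordinates and the augmented potential\<close>

lemma inner_real3: "(x::real^3) \<bullet> y = x$1 * y$1 + x$2 * y$2 + x$3 * y$3"
  by (simp add: inner_vec_def sum_3)

lemma norm_sq_real3: "(norm (x::real^3))\<^sup>2 = (x$1)\<^sup>2 + (x$2)\<^sup>2 + (x$3)\<^sup>2"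
  unfolding power2_norm_eq_inner by (simp add: inner_real3 power2_eq_square)

lemma inertia_mult_components [simp]:
  "(inertia I1 I2 *v x) $ 1 = I1 * x$1"
  "(inertia I1 I2 *v x) $ 2 = I2 * x$2"
  "(inertia I1 I2 *v x) $ 3 = I2 * x$3"
  by (simp_all add: inertia_def matrix_vector_mult_def sum_3)

lemma cross3_components [simp]:
  "cross3 x y $ 1 = x$2 * y$3 - x$3 * y$2"
  "cross3 x y $ 2 = x$3 * y$1 - x$1 * y$3"
  "cross3 x y $ 3 = x$1 * y$2 - x$2 * y$1"
  by (simp_all add: cross3_def)

lemma e1_components [simp]: "e1 $ 1 = 1" "e1 $ 2 = 0" "e1 $ 3 = 0"
  by (simp_all add: e1_def)

text \<open>The term \<open>\<eta> *\<^sub>R cross3 e1 R\<close> of the generator cancels against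
  the axial part of its angular velocity, so \<eta> enters only through the first inertia term.
  Lagrange's identity expands the remaining squared cross product.\<close>

lemma augmented_potential_eq:
  fixes B R \<xi>
  defines "\<omega> \<equiv> transpose B *v \<xi>"
  shows "augmented_potential I1 I2 (\<xi>, \<eta>) (B, R) =
      V2 I1 I2 R - 1/2 * (I1 * (\<omega>$1 - \<eta>)\<^sup>2 + I2 * ((\<omega>$2)\<^sup>2 + (\<omega>$3)\<^sup>2)
        + (\<omega> \<bullet> \<omega>) * (R \<bullet> R) - (\<omega> \<bullet> R)\<^sup>2)"
proof -
  have "\<eta> *\<^sub>R cross3 e1 R + cross3 (\<omega> - \<eta> *\<^sub>R e1) R = cross3 \<omega> R"
    by (simp add: cross3_simps)
  moreover have "(norm (cross3 \<omega> R))\<^sup>2 = (\<omega> \<bullet> \<omega>) * (R \<bullet> R) - (\<omega> \<bullet> R)\<^sup>2"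
    unfolding norm_sq_real3 inner_real3 cross3_components by algebra
  moreover have "(\<omega> - \<eta> *\<^sub>R e1) \<bullet> (inertia I1 I2 *v (\<omega> - \<eta> *\<^sub>R e1)) =
      I1 * (\<omega>$1 - \<eta>)\<^sup>2 + I2 * ((\<omega>$2)\<^sup>2 + (\<omega>$3)\<^sup>2)"
    by (simp add: inner_real3 power2_eq_square algebra_simps)
  ultimately show ?thesis
    unfolding augmented_potential_def generator_def kinetic_def prod.case snd_conv \<omega>_def[symmetric]
    by simp
qed

section \<open>Test curves in the configuration space\<close>

lemma critical_pointD:
  assumes "critical_point f q" "range c \<subseteq> config_space" "c 0 = q" "c differentiable (at 0)"
  shows "((\<lambda>t. f (c t)) has_real_derivative 0) (at 0)"
  using assms unfolding critical_point_def by blast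

lemma critical_point_translation:
  assumes "critical_point f (B, R)"
  shows "((\<lambda>t. f (B, R + t *\<^sub>R v)) has_real_derivative 0) (at 0)"
proof (rule critical_pointD[OF assms])
  show "range (\<lambda>t. (B, R + t *\<^sub>R v)) \<subseteq> config_space"
    using assms by (auto simp: critical_point_def config_space_def)
  have "((\<lambda>t. (B, R + t *\<^sub>R v)) has_derivative (\<lambda>t. (0, t *\<^sub>R v))) (at 0)"
    by (auto intro!: derivative_eq_intros)
  then show "(\<lambda>t. (B, R + t *\<^sub>R v)) differentiable (at 0)"
    by (rule differentiableI)
qed simp

text \<open>Rotations about the second and third axes suffice: when \<xi> is orthogonal to R, the
  derivative of the augmented potential along rotations about \<open>e1\<close> vanishes
  identically.\<close>

definition rot2 :: "real \<Rightarrow> real^3^3" where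
  "rot2 t = vector [vector [cos t, 0, sin t], vector [0, 1, 0], vector [- sin t, 0, cos t]]"

definition rot3 :: "real \<Rightarrow> real^3^3" where
  "rot3 t = vector [vector [cos t, - sin t, 0], vector [sin t, cos t, 0], vector [0, 0, 1]]"

lemma rot_0 [simp]: "rot2 0 = mat 1" "rot3 0 = mat 1"
  by (simp_all add: rot2_def rot3_def mat_def vec_eq_iff forall_3)

lemma rot_SO3: "rot2 t \<in> SO3" "rot3 t \<in> SO3"
  by (simp_all add: SO3_def rotation_matrix_def orthogonal_matrix rot2_def rot3_def det_3
      transpose_def matrix_matrix_mult_def mat_def vec_eq_iff forall_3 sum_3
      flip: power2_eq_square)

lemma differentiable_trigonometric:
  fixes A P S :: "'a::real_normed_vector"
  shows "(\<lambda>t. A + cos t *\<^sub>R P + sin t *\<^sub>R S) differentiable (at (x::real))"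
proof -
  have "((\<lambda>t. A + cos t *\<^sub>R P + sin t *\<^sub>R S) has_derivative
          (\<lambda>t. (- sin x * t) *\<^sub>R P + (cos x * t) *\<^sub>R S)) (at x)"
    by (auto intro!: derivative_eq_intros simp: mult.commute)
  then show ?thesis
    by (rule differentiableI)
qed

lemma rot_differentiable: "rot2 differentiable (at x)" "rot3 differentiable (at x)"
proof -
  \<comment> \<open>Matrix units; they display both rotation curves in the form
    \<open>A + cos t *\<^sub>R P + sin t *\<^sub>R S\<close>.\<close>
  let ?E = "\<lambda>i j. \<chi> k l. if k = i \<and> l = j then 1 else (0::real)"
  have rot2_eq: "rot2 = (\<lambda>t. ?E 2 2 + cos t *\<^sub>R (?E 1 1 + ?E 3 3) + sin t *\<^sub>R (?E 1 3 - ?E 3 1))"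
    by (simp add: fun_eq_iff rot2_def vec_eq_iff forall_3)
  show "rot2 differentiable (at x)"
    unfolding rot2_eq by (rule differentiable_trigonometric)
  have rot3_eq: "rot3 = (\<lambda>t. ?E 3 3 + cos t *\<^sub>R (?E 1 1 + ?E 2 2) + sin t *\<^sub>R (?E 2 1 - ?E 1 2))"
    by (simp add: fun_eq_iff rot3_def vec_eq_iff forall_3)
  show "rot3 differentiable (at x)"
    unfolding rot3_eq by (rule differentiable_trigonometric)
qed

lemma critical_point_rotation:
  assumes "critical_point f (mat 1, R)"
    and "range A \<subseteq> SO3" "A 0 = mat 1" "A differentiable (at 0)"
  shows "((\<lambda>t. f (A t, R)) has_real_derivative 0) (at 0)"
proof (rule critical_pointD[OF assms(1)])
  show "range (\<lambda>t. (A t, R)) \<subseteq> config_space"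
    using assms by (auto simp: config_space_def)
  obtain A' where "(A has_derivative A') (at 0)"
    using assms(4) by (auto simp: differentiable_def)
  then have "((\<lambda>t. (A t, R)) has_derivative (\<lambda>t. (A' t, 0))) (at 0)"
    by (auto intro!: derivative_eq_intros)
  then show "(\<lambda>t. (A t, R)) differentiable (at 0)"
    by (rule differentiableI)
qed (use assms in simp)

section \<open>The critical point equations for orthogonal \<xi> and R\<close>

lemma rotation_equations:
  assumes "critical_point (augmented_potential I1 I2 (\<xi>, \<eta>)) (mat 1, R)" and "\<xi> \<bullet> R = 0"
  shows "((I1 - I2) * \<xi>$1 - I1 * \<eta>) * \<xi>$2 = 0" "((I1 - I2) * \<xi>$1 - I1 * \<eta>) * \<xi>$3 = 0"
proof -
  let ?F = "\<lambda>A t. V2 I1 I2 R - 1/2 * (I1 * ((transpose (A t) *v \<xi>)$1 - \<eta>)\<^sup>2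
     + I2 * (((transpose (A t) *v \<xi>)$2)\<^sup>2 + ((transpose (A t) *v \<xi>)$3)\<^sup>2)
     + ((transpose (A t) *v \<xi>) \<bullet> (transpose (A t) *v \<xi>)) * (R \<bullet> R) - ((transpose (A t) *v \<xi>) \<bullet> R)\<^sup>2)"
  have orth: "\<xi>$1 * R$1 + \<xi>$2 * R$2 + \<xi>$3 * R$3 = 0"
    using assms(2) by (simp add: inner_real3)
  have 0: "(?F A has_real_derivative 0) (at 0)"
    if "range A \<subseteq> SO3" "A 0 = mat 1" "A differentiable (at 0)" for A
    using critical_point_rotation[OF assms(1) that] unfolding augmented_potential_eq .
  have t2: "transpose (rot2 t) *v \<xi> = vector [cos t * \<xi>$1 - sin t * \<xi>$3, \<xi>$2, sin t * \<xi>$1 + cos t * \<xi>$3]" for t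
    by (simp add: rot2_def matrix_vector_mult_def transpose_def sum_3 vec_eq_iff forall_3)
  have t3: "transpose (rot3 t) *v \<xi> = vector [cos t * \<xi>$1 + sin t * \<xi>$2, cos t * \<xi>$2 - sin t * \<xi>$1, \<xi>$3]" for t
    by (simp add: rot3_def matrix_vector_mult_def transpose_def sum_3 vec_eq_iff forall_3)
  \<comment> \<open>The rotated velocity keeps its length, and its inner product with R vanishes at
    t = 0, so the square of that product has no first-order term. Only the two inertia terms
    contribute.\<close>
  have "(?F rot2 has_real_derivative ((I1 - I2) * \<xi>$1 - I1 * \<eta>) * \<xi>$3) (at 0)"
    unfolding t2 inner_real3 vector_3
    by (rule derivative_eq_intros refl)+ (simp, use orth in algebra)
  moreover have "(?F rot2 has_real_derivative 0) (at 0)"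
    by (rule 0) (auto simp: rot_SO3 rot_differentiable)
  ultimately show "((I1 - I2) * \<xi>$1 - I1 * \<eta>) * \<xi>$3 = 0"
    by (rule DERIV_unique)
  have "(?F rot3 has_real_derivative - (((I1 - I2) * \<xi>$1 - I1 * \<eta>) * \<xi>$2)) (at 0)"
    unfolding t3 inner_real3 vector_3
    by (rule derivative_eq_intros refl)+ (simp, use orth in algebra)
  moreover have "(?F rot3 has_real_derivative 0) (at 0)"
    by (rule 0) (auto simp: rot_SO3 rot_differentiable)
  ultimately have "- (((I1 - I2) * \<xi>$1 - I1 * \<eta>) * \<xi>$2) = 0"
    by (rule DERIV_unique)
  then show "((I1 - I2) * \<xi>$1 - I1 * \<eta>) * \<xi>$2 = 0"
    by simp
qed

text \<open>The left side is the gradient of \<open>V2\<close> at R minus the centrifugal term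
  \<open>(norm \<xi>)\<^sup>2 *\<^sub>R R\<close>. Its inner product with any v is the derivative of
  the augmented potential in direction v.\<close>

lemma translation_equation:
  assumes "critical_point (augmented_potential I1 I2 (\<xi>, \<eta>)) (mat 1, R)"
    and "\<xi> \<bullet> R = 0" "R \<noteq> 0"
  shows "(1 / norm R ^ 3 + 3 / (2 * norm R ^ 5)
      - 15 / (2 * norm R ^ 7) * (R \<bullet> (inertia I1 I2 *v R)) - (norm \<xi>)\<^sup>2) *\<^sub>R R
      + (3 / norm R ^ 5) *\<^sub>R (inertia I1 I2 *v R) = 0" (is "?w = 0")
proof -
  let ?n = "norm R" and ?q = "R \<bullet> (inertia I1 I2 *v R)"
  have n: "?n > 0" using assms(3) by simp
  have "?w \<bullet> v = 0" for v
  proof -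
    have norm_deriv: "((\<lambda>t. norm (R + t *\<^sub>R v)) has_real_derivative (R \<bullet> v) / ?n) (at 0)"
    proof -
      have "((\<lambda>t. sqrt ((R + t *\<^sub>R v) \<bullet> (R + t *\<^sub>R v))) has_real_derivative (R \<bullet> v) / ?n) (at 0)"
        using assms(3)
        by (auto intro!: derivative_eq_intros simp: has_field_derivative_def field_simps norm_eq_sqrt_inner inner_commute)
      then show ?thesis by (simp add: norm_eq_sqrt_inner)
    qed
    have quad: "((\<lambda>t. (R + t *\<^sub>R v) \<bullet> (inertia I1 I2 *v (R + t *\<^sub>R v))) has_real_derivative
        2 * ((inertia I1 I2 *v R) \<bullet> v)) (at 0)"
      unfolding inner_real3 inertia_mult_components vector_add_component vector_scaleR_component real_scaleR_def
      by (rule derivative_eq_intros refl)+ (simp add: algebra_simps)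
    have V: "((\<lambda>t. V2 I1 I2 (R + t *\<^sub>R v)) has_real_derivative
       (1 / ?n ^ 3 + 3 / (2 * ?n ^ 5) - 15 / (2 * ?n ^ 7) * ?q) * (R \<bullet> v)
       + 3 / ?n ^ 5 * ((inertia I1 I2 *v R) \<bullet> v)) (at 0)"
      unfolding V2_def using n
      by (auto intro!: derivative_eq_intros norm_deriv quad) (simp add: field_simps eval_nat_numeral)
    have sq: "((\<lambda>t. (R + t *\<^sub>R v) \<bullet> (R + t *\<^sub>R v)) has_real_derivative 2 * (R \<bullet> v)) (at 0)"
      unfolding inner_real3 vector_add_component vector_scaleR_component real_scaleR_def
      by (rule derivative_eq_intros refl)+ (simp add: algebra_simps)
    \<comment> \<open>Orthogonality makes this inner product linear in t, so its square drops out of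
      the derivative at 0.\<close>
    have lin: "\<xi> \<bullet> (R + t *\<^sub>R v) = t * (\<xi> \<bullet> v)" for t
      using assms(2) by (simp add: inner_add_right)
    have "((\<lambda>t. augmented_potential I1 I2 (\<xi>, \<eta>) (mat 1, R + t *\<^sub>R v)) has_real_derivative ?w \<bullet> v) (at 0)"
      unfolding augmented_potential_eq transpose_mat matrix_vector_mul_lid lin
      by (rule derivative_eq_intros V sq refl)+
        (simp add: inner_add_left left_diff_distrib power2_norm_eq_inner)
    moreover have "((\<lambda>t. augmented_potential I1 I2 (\<xi>, \<eta>) (mat 1, R + t *\<^sub>R v)) has_real_derivative 0) (at 0)"
      by (rule critical_point_translation[OF assms(1)])
    ultimately show ?thesis by (rule DERIV_unique)
  qed
  then show ?thesis
    using inner_eq_zero_iff by blast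
qed

text \<open>For an eigenvector the translation equation is a scalar times R. The quadratic form and
  the linear inertia term contribute -15c/2 and 3c over \<open>norm R ^ 5\<close>, hence the
  -9c.\<close>

lemma norm_velocity_eq:
  assumes "critical_point (augmented_potential I1 I2 (\<xi>, \<eta>)) (mat 1, R)"
    and "\<xi> \<bullet> R = 0" "R \<noteq> 0" "inertia I1 I2 *v R = c *\<^sub>R R"
  shows "(norm \<xi>)\<^sup>2 = (2 * norm R ^ 2 + 3 - 9 * c) / (2 * norm R ^ 5)"
proof -
  let ?n = "norm R"
  have "(1 / ?n ^ 3 + 3 / (2 * ?n ^ 5) - 15 / (2 * ?n ^ 7) * (c * ?n\<^sup>2) - (norm \<xi>)\<^sup>2 + 3 / ?n ^ 5 * c) *\<^sub>R R = 0"
    using translation_equation[OF assms(1-3)] assms(4)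
    by (simp add: scaleR_left_distrib power2_norm_eq_inner)
  then have "(norm \<xi>)\<^sup>2 = 1 / ?n ^ 3 + 3 / (2 * ?n ^ 5) - 15 / (2 * ?n ^ 7) * (c * ?n\<^sup>2) + 3 / ?n ^ 5 * c"
    using assms(3) by simp
  also have "\<dots> = (2 * ?n ^ 2 + 3 - 9 * c) / (2 * ?n ^ 5)"
    using assms(3) by (simp add: field_simps eval_nat_numeral)
  finally show ?thesis .
qed

text \<open>The translation equation makes R an eigenvector of the inertia tensor. For distinct
  moments the eigenspaces are the symmetry axis and the plane orthogonal to it.\<close>

lemma position_eigenvector:
  assumes "critical_point (augmented_potential I1 I2 (\<xi>, \<eta>)) (mat 1, R)"
    and "\<xi> \<bullet> R = 0" "R \<noteq> 0" "I1 \<noteq> I2"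
  shows "R$1 = 0 \<or> R$2 = 0 \<and> R$3 = 0"
proof -
  define k where "k = 1 / norm R ^ 3 + 3 / (2 * norm R ^ 5)
      - 15 / (2 * norm R ^ 7) * (R \<bullet> (inertia I1 I2 *v R)) - (norm \<xi>)\<^sup>2"
  define m where "m = 3 / norm R ^ 5"
  have "k *\<^sub>R R + m *\<^sub>R (inertia I1 I2 *v R) = 0"
    using translation_equation[OF assms(1-3)] unfolding k_def m_def .
  then have "(k + m * I1) * R$1 = 0" "(k + m * I2) * R$2 = 0" "(k + m * I2) * R$3 = 0"
    by (simp_all add: vec_eq_iff forall_3 algebra_simps)
  moreover have "m \<noteq> 0"
    using assms(3) by (simp add: m_def)
  moreover have "m * I1 \<noteq> m * I2"
    using assms(4) \<open>m \<noteq> 0\<close> by simp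
  ultimately show ?thesis
    by (metis add_left_cancel mult_eq_0_iff)
qed

section \<open>Normalization by the symmetry group\<close>

lemma polar_coordinates:
  obtains p q :: real where "p\<^sup>2 + q\<^sup>2 = 1" "a = sqrt (a\<^sup>2 + b\<^sup>2) * p" "b = sqrt (a\<^sup>2 + b\<^sup>2) * q"
proof (cases "a\<^sup>2 + b\<^sup>2 = 0")
  case True
  then show ?thesis using that[of 1 0] by simp
next
  case False
  then have "(a / sqrt (a\<^sup>2 + b\<^sup>2))\<^sup>2 + (b / sqrt (a\<^sup>2 + b\<^sup>2))\<^sup>2 = 1"
    by (simp add: power_divide flip: add_divide_distrib)
  with False show ?thesis using that[of "a / sqrt (a\<^sup>2 + b\<^sup>2)" "b / sqrt (a\<^sup>2 + b\<^sup>2)"] by simp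
qed

text \<open>The element \<open>(s N, N)\<close> with \<open>s = det N\<close> fixes \<open>B = Id\<close>.\<close>

lemma translate_block_diag:
  fixes p q s :: real
  assumes "p\<^sup>2 + q\<^sup>2 = 1" "s \<in> {1, -1}"
  defines "N \<equiv> block_diag s (vector [vector [p, q], vector [- q, p]])"
  shows "(s *\<^sub>R N, N) \<in> G_axi"
    and "translate (s *\<^sub>R N, N) ((mat 1, R), (\<xi>, \<eta>)) =
      ((mat 1, vector [s * R$1, p * R$2 + q * R$3, p * R$3 - q * R$2]),
       (vector [\<xi>$1, s * (p * \<xi>$2 + q * \<xi>$3), s * (p * \<xi>$3 - q * \<xi>$2)], \<eta>))"
proof -
  have pq: "p * p + q * q = 1" "q * q + p * p = 1"
    using assms(1) by (simp_all add: power2_eq_square)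
  have s: "s * s = 1" using assms(2) by auto
  have N: "N = vector [vector [s, 0, 0], vector [0, p, q], vector [0, - q, p]]"
    by (simp add: N_def block_diag_def vector_2)
  have NN: "N ** transpose N = mat 1" "transpose N ** N = mat 1"
    using pq s by (simp_all add: N matrix_matrix_mult_def transpose_def mat_def vec_eq_iff
      forall_3 sum_3 mult.commute)
  have det: "det N = s"
    using pq by (simp add: N det_3) algebra
  have "orthogonal_matrix (vector [vector [p, q], vector [- q, p]] :: real^2^2)"
    using pq by (simp add: orthogonal_matrix matrix_matrix_mult_def transpose_def mat_def
      vec_eq_iff forall_2 sum_2 vector_2 mult.commute)
  then have "N \<in> Gamma_axi"
    using assms(2) unfolding Gamma_axi_def N_def by blast
  moreover have "det (s *\<^sub>R N) = 1"
    using pq s by (simp add: N det_3) algebra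
  then have "s *\<^sub>R N \<in> SO3"
    using NN s by (simp add: SO3_def rotation_matrix_def orthogonal_matrix transpose_scalar
      scalar_matrix_assoc matrix_scalar_ac)
  ultimately show "(s *\<^sub>R N, N) \<in> G_axi"
    by (simp add: G_axi_def)
  \<comment> \<open>The factor \<open>det N = s\<close> of the action meets the s of the first
    component, leaving \<open>N ** transpose N\<close>.\<close>
  have "act (s *\<^sub>R N, N) (mat 1, R) = (mat 1, N *v R)"
    using NN s by (simp add: act_def det flip: scalar_matrix_assoc)
  \<comment> \<open>The lower block is a rotation even when s = -1, so \<eta> keeps its
    sign.\<close>
  moreover have "chi_axi N = 1"
    using pq by (simp add: chi_axi_def N det_2 vector_2)
  ultimately show "translate (s *\<^sub>R N, N) ((mat 1, R), (\<xi>, \<eta>)) =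
      ((mat 1, vector [s * R$1, p * R$2 + q * R$3, p * R$3 - q * R$2]),
       (vector [\<xi>$1, s * (p * \<xi>$2 + q * \<xi>$3), s * (p * \<xi>$3 - q * \<xi>$2)], \<eta>))"
    using s by (simp add: translate_def Ad_def N matrix_vector_mult_def sum_3 vec_eq_iff forall_3
      algebra_simps flip: mult.assoc)
qed

theorem proposition4p1:
  fixes I1 I2 \<eta> :: real and R \<xi> :: "real^3"
  assumes "0 < I1" "I1 < 1/2" "0 < I2" "I2 < 1/2" "I1 + 2 * I2 = 1"
    and "relative_equilibrium I1 I2 ((mat 1, R), (\<xi>, \<eta>))"
    and "\<xi> \<bullet> R = 0"
    and "I1 \<noteq> I2 \<or> \<eta> \<noteq> 0"
    and "\<xi> \<noteq> 0 \<or> \<eta> = 0"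
  shows "\<exists>g\<in>G_axi. \<exists>R' \<zeta>'.
           translate g ((mat 1, R), (\<xi>, \<eta>)) = ((mat 1, R'), \<zeta>') \<and>
           (cylindrical_RE I1 I2 R' \<zeta>' \<or> hyperbolic_RE I1 I2 R' \<zeta>' \<or> isolated_RE I1 I2 R' \<zeta>')"
proof -
  have crit: "critical_point (augmented_potential I1 I2 (\<xi>, \<eta>)) (mat 1, R)" and R0: "R \<noteq> 0"
    using assms(6) by (auto simp: relative_equilibrium_def)
  note rot = rotation_equations[OF crit assms(7)]
  have orth: "\<xi>$1 * R$1 + \<xi>$2 * R$2 + \<xi>$3 * R$3 = 0"
    using assms(7) by (simp add: inner_real3)
  have \<xi>0: "\<xi> = 0 \<longleftrightarrow> \<xi>$1 = 0 \<and> \<xi>$2 = 0 \<and> \<xi>$3 = 0"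
    by (simp add: vec_eq_iff forall_3)
  have "R$1 = 0 \<or> R$2 = 0 \<and> R$3 = 0"
  proof (cases "I1 = I2")
    \<comment> \<open>The rotation equations reduce to \<eta> times the transverse components of
      \<xi>, and here \<eta> is nonzero. So \<xi> is a nonzero axial vector, and R is orthogonal to
      the axis.\<close>
    case True
    then have "\<xi>$2 = 0" "\<xi>$3 = 0" "\<xi>$1 \<noteq> 0"
      using rot assms(1,8,9) \<xi>0 by auto
    then show ?thesis using orth by simp
  next
    case False
    then show ?thesis using position_eigenvector[OF crit assms(7) R0] by simp
  qed
  then consider (equatorial) "R$1 = 0" | (axial) "R$2 = 0" "R$3 = 0" "R$1 \<noteq> 0"
    by blast
  then show ?thesis
  proof cases
    case axial
    \<comment> \<open>Reflecting the axis by the sign of \<open>R$1\<close> puts R on the positive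
      half-axis.\<close>
    define s where "s = sgn (R$1)"
    have s: "s \<in> {1, -1}" "s * R$1 = \<bar>R$1\<bar>" "s\<^sup>2 = 1"
      using axial by (auto simp: s_def sgn_if)
    have normR: "norm R = \<bar>R$1\<bar>"
      using axial by (simp add: norm_eq_sqrt_inner inner_real3)
    have "inertia I1 I2 *v R = I1 *\<^sub>R R"
      using axial by (simp add: vec_eq_iff forall_3)
    from norm_velocity_eq[OF crit assms(7) R0 this]
    have norm\<xi>: "(norm \<xi>)\<^sup>2 = (2 * \<bar>R$1\<bar>\<^sup>2 + 3 - 9 * I1) / (2 * \<bar>R$1\<bar> ^ 5)"
      unfolding normR .
    have \<xi>1: "\<xi>$1 = 0"
      using orth axial by simp
    \<comment> \<open>With \<xi>$1 = 0, a nonzero \<eta> would make both transverse components of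
      \<xi> vanish by the rotation equations, against the hypothesis that \<xi> = 0 implies \<eta> =
      0.\<close>
    then have \<eta>: "\<eta> = 0"
      using rot assms(1,9) \<xi>0 by auto
    obtain p q where pq: "p\<^sup>2 + q\<^sup>2 = 1" "\<xi>$2 = sqrt ((\<xi>$2)\<^sup>2 + (\<xi>$3)\<^sup>2) * p"
        "\<xi>$3 = sqrt ((\<xi>$2)\<^sup>2 + (\<xi>$3)\<^sup>2) * q"
      by (rule polar_coordinates)
    define h where "h = sqrt ((\<xi>$2)\<^sup>2 + (\<xi>$3)\<^sup>2)"
    have h: "\<xi>$2 = h * p" "\<xi>$3 = h * q" "h\<^sup>2 = (norm \<xi>)\<^sup>2"
      using pq \<xi>1 by (simp_all add: h_def norm_sq_real3)
    have "p * \<xi>$2 + q * \<xi>$3 = h" "p * \<xi>$3 - q * \<xi>$2 = 0"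
      using pq(1) unfolding h by (algebra, simp)
    then have "isolated_RE I1 I2 (vector [s * R$1, p * R$2 + q * R$3, p * R$3 - q * R$2])
       (vector [\<xi>$1, s * (p * \<xi>$2 + q * \<xi>$3), s * (p * \<xi>$3 - q * \<xi>$2)], \<eta>)"
      unfolding isolated_RE_def prod.case using axial s \<xi>1 \<eta> h norm\<xi>
      \<comment> \<open>The group element acts on \<xi> by \<open>s *\<^sub>R N\<close>, so the
        second component becomes \<open>s * h\<close>.\<close>
      by (intro exI[of _ "\<bar>R$1\<bar>"] conjI exI[of _ "s * h"]) (simp_all add: norm_sq_real3 power_mult_distrib)
    then show ?thesis
      using translate_block_diag[OF pq(1) s(1)] by blast
  next
    case equatorial
    define r where "r = norm R"
    have r: "r > 0" using R0 by (simp add: r_def)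
    have r_eq: "r = sqrt ((R$2)\<^sup>2 + (R$3)\<^sup>2)"
      using equatorial by (simp add: r_def norm_eq_sqrt_inner inner_real3 power2_eq_square)
    obtain p q where pq: "p\<^sup>2 + q\<^sup>2 = 1" "R$2 = r * p" "R$3 = r * q"
      unfolding r_eq by (rule polar_coordinates)
    have R': "p * R$2 + q * R$3 = r" "p * R$3 - q * R$2 = 0"
      using pq(1) unfolding pq(2,3) by (algebra, simp)
    have "inertia I1 I2 *v R = I2 *\<^sub>R R"
      using equatorial by (simp add: vec_eq_iff forall_3)
    from norm_velocity_eq[OF crit assms(7) R0 this]
    have norm\<xi>: "(norm \<xi>)\<^sup>2 = (2 * r\<^sup>2 + 3 - 9 * I2) / (2 * r ^ 5)"
      unfolding r_def .
    \<comment> \<open>The third component of \<xi> after the rotation that takes R to the second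
      axis; the second one vanishes by orthogonality.\<close>
    define c where "c = p * \<xi>$3 - q * \<xi>$2"
    have "r * (p * \<xi>$2 + q * \<xi>$3) = 0"
      using orth equatorial pq(2,3) by (simp add: algebra_simps)
    then have \<xi>2: "p * \<xi>$2 + q * \<xi>$3 = 0"
      using r by simp
    then have \<xi>_eq: "\<xi>$2 = - q * c" "\<xi>$3 = p * c"
      using pq(1) unfolding c_def by algebra+
    have norm_c: "(norm \<xi>)\<^sup>2 = (\<xi>$1)\<^sup>2 + c\<^sup>2"
      using pq(1) unfolding norm_sq_real3 \<xi>_eq by algebra
    let ?R = "vector [0, r, 0] :: real^3" and ?\<xi> = "vector [\<xi>$1, 0, c] :: real^3"
    have norm_eq: "norm ?\<xi> = norm \<xi>"
      by (rule power2_eq_imp_eq) (simp_all add: norm_c norm_sq_real3[of "vector _"])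
    have "cylindrical_RE I1 I2 ?R (?\<xi>, \<eta>) \<or> hyperbolic_RE I1 I2 ?R (?\<xi>, \<eta>)"
    proof (cases "c = 0")
      case True
      then have "\<xi>$1 = 0 \<longrightarrow> \<eta> = 0"
        using assms(9) \<xi>_eq \<xi>0 by simp
      \<comment> \<open>The witness for \<alpha> is \<open>- \<eta> / \<xi>$1\<close>; if \<xi>$1 =
        0, both sides are 0.\<close>
      then have "\<eta> = - (- \<eta> / \<xi>$1) * \<xi>$1"
        by auto
      then have "cylindrical_RE I1 I2 ?R (?\<xi>, \<eta>)"
        unfolding cylindrical_RE_def prod.case norm_eq using r norm\<xi> True by blast
      then show ?thesis ..
    next
      case False
      let ?m = "norm \<xi>"
      have m: "?m \<noteq> 0"
        using False by (auto simp: c_def)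
      \<comment> \<open>In the hyperbolic form the third component carries the cosine and the first
        one the sine.\<close>
      have "(c / ?m)\<^sup>2 + (\<xi>$1 / ?m)\<^sup>2 = 1"
        using False unfolding power_divide norm_c add_divide_distrib[symmetric]
        by (simp add: add.commute sum_power2_eq_zero_iff)
      then obtain t where t: "0 \<le> t" "t < 2 * pi" "c / ?m = cos t" "\<xi>$1 / ?m = sin t"
        using sincos_total_2pi by metis
      have comp: "\<xi>$1 = ?m * sin t" "c = ?m * cos t"
        using t(3,4) m by (simp_all add: field_simps)
      have "\<xi>$2 \<noteq> 0 \<or> \<xi>$3 \<noteq> 0"
        using False pq(1) \<xi>_eq by auto
      then have "(I1 - I2) * \<xi>$1 - I1 * \<eta> = 0"
        using rot by auto
      then have "\<eta> = - ((I2 - I1) / I1) * \<xi>$1"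
        using assms(1) by (simp add: field_simps)
      then have \<eta>: "\<eta> = - ((I2 - I1) / I1) * ?m * sin t"
        using comp(1) by simp
      \<comment> \<open>The excluded angle would make c, the transverse part of \<xi>,
        vanish.\<close>
      have "t \<noteq> pi/2"
        using False comp(2) cos_pi_half by fastforce
      moreover have "?\<xi> = ?m *\<^sub>R vector [sin t, 0, cos t]"
        using comp by (simp add: vec_eq_iff forall_3)
      ultimately have "hyperbolic_RE I1 I2 ?R (?\<xi>, \<eta>)"
        unfolding hyperbolic_RE_def prod.case norm_eq
        using r norm\<xi> t(1,2) \<eta> by (intro exI[of _ r] conjI bexI[of _ t]) auto
      then show ?thesis ..
    qed
    \<comment> \<open>Here a rotation about the axis suffices, so s = 1.\<close>
    then show ?thesis
      using translate_block_diag(1)[OF pq(1), of 1] translate_block_diag(2)[OF pq(1), of 1 R \<xi> \<eta>]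
        equatorial R' \<xi>2 unfolding c_def by fastforce
  qed
qed

end
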